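(* Let $\Gamma$ be a linear set of functions containing $\gamma_0$. Then $\psi(w,\gamma,\alpha,\theta)$ is doubly robust if and only if both of the following hold: for every $\gamma\in\Gamma$ $$\left.\frac{\partial\bar\psi((1-\tau)\gamma_0+\tau\gamma,\alpha_0,\theta_0)}{\partial\tau}\right|_{\tau=0}=0,$$ and $\bar\psi(\gamma,\alpha_0,\theta_0)$ is affine in $\gamma\in\Gamma$.
   Context: $\psi(w,\gamma,\alpha,\theta)=g(w,\gamma,\theta)+\phi(w,\gamma,\alpha,\theta)$ is the sum of identifying moment functions $g$ and a nonparametric influence function $\phi$; $\bar\psi(\gamma,\alpha,\theta)=E[\psi(W,\gamma,\alpha,\theta)]$, assumed to exist. $\gamma_0,\alpha_0,\theta_0$ are the true values. Standing properties: $E[g(W,\gamma_0,\theta_0)]=0$ and $E[\phi(W,\gamma_0,\alpha,\theta)]=0$ for all $\alpha$ and $\theta$ (so $\bar\psi(\gamma_0,\alpha,\theta_0)=0$ for all $\alpha$). $\psi$ is called doubly robust (over $\Gamma$) if $0=\bar\psi(\gamma,\alpha_0,\theta_0)=\bar\psi(\gamma_0,\alpha,\theta_0)$ for all $\gamma\in\Gamma$ and all $\alpha$. *)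

theory Defs
  imports "HOL-Probability.Probability" "HOL-Library.Function_Algebras"
begin

instantiation "fun" :: (type, real_vector) real_vector
begin

definition scaleR_fun :: "real \<Rightarrow> ('a \<Rightarrow> 'b) \<Rightarrow> 'a \<Rightarrow> 'b" where
  "scaleR_fun c f = (\<lambda>x. c *\<^sub>R f x)"

instance
  by standard (simp_all add: scaleR_fun_def fun_eq_iff scaleR_add_right scaleR_add_left)

end

definition moment_fun ::
  "('w \<Rightarrow> 'f \<Rightarrow> 'p \<Rightarrow> 'k) \<Rightarrow> ('w \<Rightarrow> 'f \<Rightarrow> 'a \<Rightarrow> 'p \<Rightarrow> 'k)
    \<Rightarrow> 'w \<Rightarrow> 'f \<Rightarrow> 'a \<Rightarrow> 'p \<Rightarrow> 'k::plus" where
  "moment_fun g \<phi> w \<gamma> \<alpha> \<theta> = g w \<gamma> \<theta> + \<phi> w \<gamma> \<alpha> \<theta>"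

definition mean_moment ::
  "'s measure \<Rightarrow> ('s \<Rightarrow> 'w) \<Rightarrow> ('w \<Rightarrow> 'f \<Rightarrow> 'a \<Rightarrow> 'p \<Rightarrow> 'k)
    \<Rightarrow> 'f \<Rightarrow> 'a \<Rightarrow> 'p \<Rightarrow> 'k::euclidean_space" where
  "mean_moment M W \<psi> \<gamma> \<alpha> \<theta> = (\<integral>\<omega>. \<psi> (W \<omega>) \<gamma> \<alpha> \<theta> \<partial>M)"

definition doubly_robust ::
  "'s measure \<Rightarrow> ('s \<Rightarrow> 'w) \<Rightarrow> ('w \<Rightarrow> 'f \<Rightarrow> 'a \<Rightarrow> 'p \<Rightarrow> 'k::euclidean_space)
    \<Rightarrow> 'f set \<Rightarrow> 'a set \<Rightarrow> 'f \<Rightarrow> 'a \<Rightarrow> 'p \<Rightarrow> bool" where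
  "doubly_robust M W \<psi> \<Gamma> A \<gamma>\<^sub>0 \<alpha>\<^sub>0 \<theta>\<^sub>0 \<longleftrightarrow>
    (\<forall>\<gamma>\<in>\<Gamma>. \<forall>\<alpha>\<in>A.
      mean_moment M W \<psi> \<gamma> \<alpha>\<^sub>0 \<theta>\<^sub>0 = 0 \<and> mean_moment M W \<psi> \<gamma>\<^sub>0 \<alpha> \<theta>\<^sub>0 = 0)"

text \<open>Preservation of all two-point affine combinations, with unrestricted real weights;
  on a linear subspace this says that the map is a constant plus a linear map.\<close>

definition affine_map_on ::
  "'f::real_vector set \<Rightarrow> ('f \<Rightarrow> 'k::real_vector) \<Rightarrow> bool" where
  "affine_map_on \<Gamma> F \<longleftrightarrow>
    (\<forall>\<gamma>\<in>\<Gamma>. \<forall>\<gamma>'\<in>\<Gamma>. \<forall>t.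
      F ((1 - t) *\<^sub>R \<gamma> + t *\<^sub>R \<gamma>') = (1 - t) *\<^sub>R F \<gamma> + t *\<^sub>R F \<gamma>')"

end

theory Submission imports Defs
begin

text \<open>At \<gamma>0 the mean moment vanishes for every \<alpha> in \<open>A\<close>, because
  both summands of \<psi> have mean zero there. Double robustness therefore only says that
  F(\<gamma>), the mean moment at \<alpha>0 and \<theta>0, is zero on all of \<Gamma>. Since
  F(\<gamma>0) = 0, affinity makes F equal to \<tau> F(\<gamma>) at the point (1 - \<tau>) \<gamma>0
  + \<tau> \<gamma>, so its derivative at \<tau> = 0 is F(\<gamma>) itself, and a zero derivative
  forces F(\<gamma>) = 0. Conversely, the zero map is affine and has zero derivatives along these
  lines. \<open>vanishes_on_subspace_iff\<close> is this argument for an abstract F;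
  \<open>mean_moment_moment_fun\<close> supplies the value at \<gamma>0.\<close>

lemma vanishes_on_subspace_iff:
  fixes F :: "'f::real_vector \<Rightarrow> 'k::real_normed_vector"
  assumes S: "subspace S" and x0: "x0 \<in> S" and F0: "F x0 = 0"
  shows "(\<forall>x\<in>S. F x = 0) \<longleftrightarrow>
    (\<forall>x\<in>S. ((\<lambda>t. F ((1 - t) *\<^sub>R x0 + t *\<^sub>R x)) has_vector_derivative 0) (at 0)) \<and>
    affine_map_on S F"
proof (intro iffI conjI)
  \<comment> \<open>A subspace contains the whole line through two of its points, so a map vanishing
    on \<open>S\<close> is identically zero along that line.\<close>
  have comb: "(1 - t) *\<^sub>R x + t *\<^sub>R y \<in> S" if "x \<in> S" "y \<in> S" for x y t
    using S that by (simp add: subspace_add subspace_scale)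
  assume "\<forall>x\<in>S. F x = 0"
  then show "\<forall>x\<in>S. ((\<lambda>t. F ((1 - t) *\<^sub>R x0 + t *\<^sub>R x)) has_vector_derivative 0) (at 0)"
    and "affine_map_on S F"
    using comb x0 by (simp_all add: affine_map_on_def)
next
  assume "(\<forall>x\<in>S. ((\<lambda>t. F ((1 - t) *\<^sub>R x0 + t *\<^sub>R x)) has_vector_derivative 0) (at 0)) \<and>
    affine_map_on S F"
  then have deriv: "\<And>x. x \<in> S \<Longrightarrow>
      ((\<lambda>t. F ((1 - t) *\<^sub>R x0 + t *\<^sub>R x)) has_vector_derivative 0) (at 0)"
    and aff: "affine_map_on S F"
    by auto
  show "\<forall>x\<in>S. F x = 0"
  proof
    fix x assume x: "x \<in> S"
    \<comment> \<open>The term (1 - t) F(x0) drops out. Affinity holds for every real weight, so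
      this is an equality of functions on the whole line, as a two-sided derivative at 0
      requires.\<close>
    have "(\<lambda>t. F ((1 - t) *\<^sub>R x0 + t *\<^sub>R x)) = (\<lambda>t. t *\<^sub>R F x)"
      using aff x x0 F0 by (simp add: affine_map_on_def)
    with deriv[OF x] have "((\<lambda>t. t *\<^sub>R F x) has_vector_derivative 0) (at 0)"
      by simp
    moreover have "((\<lambda>t. t *\<^sub>R F x) has_vector_derivative F x) (at 0)"
      by (auto intro!: derivative_eq_intros)
    \<comment> \<open>The same function has derivatives 0 and \<open>F x\<close> at 0; derivatives
      are unique.\<close>
    ultimately show "F x = 0"
      using vector_derivative_unique_at by blast
  qed
qed

text \<open>Linearity of the integral, with each summand integrable on its own. It is applied at
  \<gamma>0, where this separate integrability is assumed.\<close>

lemma mean_moment_moment_fun: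
  assumes "integrable M (\<lambda>\<omega>. g (W \<omega>) \<gamma> \<theta>)" and "integrable M (\<lambda>\<omega>. \<phi> (W \<omega>) \<gamma> \<alpha> \<theta>)"
  shows "mean_moment M W (moment_fun g \<phi>) \<gamma> \<alpha> \<theta> =
    (\<integral>\<omega>. g (W \<omega>) \<gamma> \<theta> \<partial>M) + (\<integral>\<omega>. \<phi> (W \<omega>) \<gamma> \<alpha> \<theta> \<partial>M)"
  using assms by (simp add: mean_moment_def moment_fun_def)

theorem theorem7:
  fixes M :: "'s measure" and N :: "'w measure" and W :: "'s \<Rightarrow> 'w"
    and \<Gamma> :: "('x \<Rightarrow> 'b::euclidean_space) set"
    and A :: "('y \<Rightarrow> 'c::euclidean_space) set"
    and \<Theta> :: "'p::euclidean_space set"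
    and g :: "'w \<Rightarrow> ('x \<Rightarrow> 'b) \<Rightarrow> 'p \<Rightarrow> 'k::euclidean_space"
    and \<phi> :: "'w \<Rightarrow> ('x \<Rightarrow> 'b) \<Rightarrow> ('y \<Rightarrow> 'c) \<Rightarrow> 'p \<Rightarrow> 'k"
    and \<psi> :: "'w \<Rightarrow> ('x \<Rightarrow> 'b) \<Rightarrow> ('y \<Rightarrow> 'c) \<Rightarrow> 'p \<Rightarrow> 'k"
    and \<gamma>\<^sub>0 :: "'x \<Rightarrow> 'b" and \<alpha>\<^sub>0 :: "'y \<Rightarrow> 'c" and \<theta>\<^sub>0 :: 'p
  assumes "prob_space M"
    and "W \<in> measurable M N"
    and "subspace \<Gamma>"
    and "\<gamma>\<^sub>0 \<in> \<Gamma>" and "\<alpha>\<^sub>0 \<in> A" and "\<theta>\<^sub>0 \<in> \<Theta>"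
    and "\<psi> = moment_fun g \<phi>"
    and "\<And>\<gamma> \<alpha> \<theta>. \<gamma> \<in> \<Gamma> \<Longrightarrow> \<alpha> \<in> A \<Longrightarrow> \<theta> \<in> \<Theta> \<Longrightarrow> integrable M (\<lambda>\<omega>. \<psi> (W \<omega>) \<gamma> \<alpha> \<theta>)"
    and "integrable M (\<lambda>\<omega>. g (W \<omega>) \<gamma>\<^sub>0 \<theta>\<^sub>0)"
    and "(\<integral>\<omega>. g (W \<omega>) \<gamma>\<^sub>0 \<theta>\<^sub>0 \<partial>M) = 0"
    and "\<And>\<alpha> \<theta>. \<alpha> \<in> A \<Longrightarrow> \<theta> \<in> \<Theta> \<Longrightarrow> integrable M (\<lambda>\<omega>. \<phi> (W \<omega>) \<gamma>\<^sub>0 \<alpha> \<theta>)"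
    and "\<And>\<alpha> \<theta>. \<alpha> \<in> A \<Longrightarrow> \<theta> \<in> \<Theta> \<Longrightarrow> (\<integral>\<omega>. \<phi> (W \<omega>) \<gamma>\<^sub>0 \<alpha> \<theta> \<partial>M) = 0"
  shows "doubly_robust M W \<psi> \<Gamma> A \<gamma>\<^sub>0 \<alpha>\<^sub>0 \<theta>\<^sub>0 \<longleftrightarrow>
    (\<forall>\<gamma>\<in>\<Gamma>. ((\<lambda>\<tau>. mean_moment M W \<psi> ((1 - \<tau>) *\<^sub>R \<gamma>\<^sub>0 + \<tau> *\<^sub>R \<gamma>) \<alpha>\<^sub>0 \<theta>\<^sub>0)
        has_vector_derivative 0) (at 0)) \<and>
    affine_map_on \<Gamma> (\<lambda>\<gamma>. mean_moment M W \<psi> \<gamma> \<alpha>\<^sub>0 \<theta>\<^sub>0)"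
proof -
  have zero: "mean_moment M W \<psi> \<gamma>\<^sub>0 \<alpha> \<theta>\<^sub>0 = 0" if "\<alpha> \<in> A" for \<alpha>
    using assms that by (simp add: mean_moment_moment_fun)
  \<comment> \<open>The half of double robustness that varies \<alpha> is now automatic. Membership
    of \<alpha>0 in \<open>A\<close> keeps the quantifier over \<alpha> from being vacuous, so the
    other half can be extracted.\<close>
  then have "doubly_robust M W \<psi> \<Gamma> A \<gamma>\<^sub>0 \<alpha>\<^sub>0 \<theta>\<^sub>0 \<longleftrightarrow>
      (\<forall>\<gamma>\<in>\<Gamma>. mean_moment M W \<psi> \<gamma> \<alpha>\<^sub>0 \<theta>\<^sub>0 = 0)"
    using \<open>\<alpha>\<^sub>0 \<in> A\<close> by (auto simp: doubly_robust_def)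
  also have "\<dots> \<longleftrightarrow>
    (\<forall>\<gamma>\<in>\<Gamma>. ((\<lambda>\<tau>. mean_moment M W \<psi> ((1 - \<tau>) *\<^sub>R \<gamma>\<^sub>0 + \<tau> *\<^sub>R \<gamma>) \<alpha>\<^sub>0 \<theta>\<^sub>0)
        has_vector_derivative 0) (at 0)) \<and>
    affine_map_on \<Gamma> (\<lambda>\<gamma>. mean_moment M W \<psi> \<gamma> \<alpha>\<^sub>0 \<theta>\<^sub>0)"
    using \<open>subspace \<Gamma>\<close> \<open>\<gamma>\<^sub>0 \<in> \<Gamma>\<close> zero[OF \<open>\<alpha>\<^sub>0 \<in> A\<close>]
    by (rule vanishes_on_subspace_iff[where F = "\<lambda>\<gamma>. mean_moment M W \<psi> \<gamma> \<alpha>\<^sub>0 \<theta>\<^sub>0"])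
  finally show ?thesis .
qed

end
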